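(* For $N=2$ and $N=3$, the set $\mathcal{R}_N$ is dense in $\mathbb{R}^N$.
   Context: A rational distance set $\mathrm{RDS}(N)$ on the parabola $y=x^2$ is a set of $N$ (distinct) points on the parabola with rational coordinates such that all pairwise Euclidean distances are rational. $\mathcal{R}_N\subseteq\mathbb{Q}^N\subseteq\mathbb{R}^N$ denotes the set of all $N$-tuples $(x_1,\dots,x_N)$ such that $\{(x_i,x_i^2):1\le i\le N\}$ is an $\mathrm{RDS}(N)$. *)

theory Defs
  imports "HOL-Analysis.Analysis"
begin

definition parabola :: "(real \<times> real) set" where
  "parabola = {(x, y). y = x\<^sup>2}"

(* The metric on real \<times> real is the Euclidean one (dist_prod_def). *)
definition rational_distance_set :: "nat \<Rightarrow> (real \<times> real) set \<Rightarrow> bool" where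
  "rational_distance_set N S \<longleftrightarrow>
     finite S \<and> card S = N \<and> S \<subseteq> parabola \<and> S \<subseteq> \<rat> \<times> \<rat> \<and>
     (\<forall>p\<in>S. \<forall>q\<in>S. dist p q \<in> \<rat>)"

(* Here N is the size of the index type. The cardinality requirement in
   rational_distance_set forces the entries of the tuple to be distinct. *)
definition rds_tuples :: "(real ^ 'n::finite) set" where
  "rds_tuples = {x. rational_distance_set CARD('n) {(x $ i, (x $ i)\<^sup>2) | i. i \<in> UNIV}}"

end

(* The points over a and b are at distance |a - b| sqrt(1 + (a + b)^2), so only the pairwise sums
   matter: they have to lie in H = {s rational. 1 + s^2 is a rational square}. Since
   s = (t - 1/t)/2 parametrises H by the nonzero rationals t, H is dense in the line.
   For N = 3 the three pairwise sums are linear coordinates on the space of tuples and may be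
   chosen freely in H; for N = 2 one chooses one coordinate in the rationals and the sum in H. *)
theory Submission
  imports Defs
begin

text \<open>This is the set H from above. The chord through the points over a and b has slope a + b,
  and a slope s in H is the ratio of the legs s and 1 of a right triangle with all sides
  rational.\<close>

definition pythagorean_slopes :: "real set" where
  "pythagorean_slopes = {s \<in> \<rat>. sqrt (1 + s\<^sup>2) \<in> \<rat>}"

lemma dist_parabola:
  fixes a b :: real
  shows "dist (a, a\<^sup>2) (b, b\<^sup>2) = \<bar>a - b\<bar> * sqrt (1 + (a + b)\<^sup>2)"
proof -
  have "(a - b)\<^sup>2 + (a\<^sup>2 - b\<^sup>2)\<^sup>2 = (a - b)\<^sup>2 * (1 + (a + b)\<^sup>2)"
    by (simp add: power2_eq_square algebra_simps)
  then show ?thesis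
    by (simp add: dist_prod_def dist_real_def real_sqrt_mult)
qed

lemma rational_param_in_pythagorean_slopes:
  fixes t :: real
  assumes "t \<in> \<rat>" "t > 0"
  shows "(t - 1 / t) / 2 \<in> pythagorean_slopes"
proof -
  have "1 + ((t - 1 / t) / 2)\<^sup>2 = ((t + 1 / t) / 2)\<^sup>2"
    using assms by (simp add: power2_eq_square field_simps)
  then have "sqrt (1 + ((t - 1 / t) / 2)\<^sup>2) = (t + 1 / t) / 2"
    using assms by simp
  also have "\<dots> \<in> \<rat>"
    using assms by simp
  finally show ?thesis
    using assms by (simp add: pythagorean_slopes_def)
qed

text \<open>The parametrisation \<open>g\<close> increases on the positive reals and has the right
  inverse \<open>h\<close>, so a rational parameter between \<open>h a\<close> and
  \<open>h b\<close> is sent to an element of H between a and b.\<close>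

lemma pythagorean_slopes_between:
  fixes a b :: real
  assumes "a < b"
  shows "\<exists>s\<in>pythagorean_slopes. a < s \<and> s < b"
proof -
  \<comment> \<open>\<open>h x\<close> is the positive root t of t * t - 2 * x * t - 1 = 0, which is
    the equation \<open>g t = x\<close> cleared of denominators.\<close>
  define h :: "real \<Rightarrow> real" where "h x = x + sqrt (1 + x\<^sup>2)" for x
  define g :: "real \<Rightarrow> real" where "g t = (t - 1 / t) / 2" for t
  have h_pos: "h x > 0" for x
  proof -
    have "\<bar>x\<bar> < sqrt (1 + x\<^sup>2)"
      by (rule real_less_rsqrt) simp
    then show ?thesis unfolding h_def by linarith
  qed
  have gh: "g (h x) = x" for x
  proof -
    have "1 + x\<^sup>2 \<ge> 0" by simp
    then have "h x * (sqrt (1 + x\<^sup>2) - x) = 1"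
      unfolding h_def by (simp add: algebra_simps power2_eq_square[symmetric])
    then have "1 / h x = sqrt (1 + x\<^sup>2) - x"
      using h_pos[of x] by (simp add: field_simps)
    then show ?thesis by (simp add: g_def h_def)
  qed
  have g_mono: "g u < g v" if "0 < u" "u < v" for u v
    using that frac_less2[of 1 1 u v] by (simp add: g_def)
  \<comment> \<open>Monotonicity of \<open>h\<close> is inherited from that of \<open>g\<close>
    through \<open>gh\<close>.\<close>
  have "h a < h b"
  proof (rule ccontr)
    assume "\<not> h a < h b"
    then have "g (h b) \<le> g (h a)"
      using g_mono[OF h_pos[of b], of "h a"] by (cases "h a = h b") auto
    then show False using assms by (simp add: gh)
  qed
  then obtain t where t: "t \<in> \<rat>" "h a < t" "t < h b"
    using Rats_dense_in_real by blast
  have "t > 0" using h_pos[of a] t(2) by linarith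
  moreover have "a < g t" using g_mono[OF h_pos t(2)] by (simp add: gh)
  moreover have "g t < b" using g_mono[OF \<open>t > 0\<close> t(3)] by (simp add: gh)
  ultimately show ?thesis
    using rational_param_in_pythagorean_slopes[OF t(1)] unfolding g_def by blast
qed

text \<open>Removing finitely many points from a ball leaves a nonempty open set, which contains an
  interval and hence a point of H. The set \<open>F\<close> serves later to keep the coordinates of
  a tuple distinct.\<close>

lemma pythagorean_slopes_approx_avoiding:
  fixes c e :: real
  assumes "e > 0" "finite F"
  shows "\<exists>s\<in>pythagorean_slopes. \<bar>s - c\<bar> < e \<and> s \<notin> F"
proof -
  have "open (ball c e - F)"
    using assms(2) by (intro open_Diff finite_imp_closed) auto
  moreover have "ball c e - F \<noteq> {}"
  proof -
    have "infinite (ball c e)"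
      using assms(1) by (simp add: ball_eq_greaterThanLessThan infinite_Ioo)
    then show ?thesis using assms(2) by (metis Diff_eq_empty_iff finite_subset)
  qed
  ultimately obtain x d where x: "d > 0" "ball x d \<subseteq> ball c e - F"
    by (metis ex_in_conv open_contains_ball)
  obtain s where s: "s \<in> pythagorean_slopes" "x < s" "s < x + d"
    using pythagorean_slopes_between[of x "x + d"] x(1) by auto
  then have "s \<in> ball x d" by (simp add: dist_real_def)
  then show ?thesis using x(2) s(1) by (force simp: dist_real_def)
qed

text \<open>Sums are constrained only for distinct indices: a point has distance 0 to itself,
  whether or not twice its abscissa lies in H.\<close>

lemma in_rds_tuplesI:
  fixes x :: "real ^ 'n"
  assumes rat: "\<And>i. x $ i \<in> \<rat>"
    and dist: "\<And>i j. i \<noteq> j \<Longrightarrow> x $ i \<noteq> x $ j"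
    and sums: "\<And>i j. i \<noteq> j \<Longrightarrow> x $ i + x $ j \<in> pythagorean_slopes"
  shows "x \<in> rds_tuples"
proof -
  let ?p = "\<lambda>i. (x $ i, (x $ i)\<^sup>2)"
  have eq: "{?p i | i. i \<in> UNIV} = range ?p" by auto
  have "inj ?p" using dist by (auto intro!: injI)
  then have "card (range ?p) = CARD('n)" by (rule card_image)
  moreover have "dist (?p i) (?p j) \<in> \<rat>" for i j
    using sums[of i j] rat
    by (cases "i = j") (auto simp: dist_parabola pythagorean_slopes_def)
  ultimately have "rational_distance_set CARD('n) (range ?p)"
    using rat by (auto simp: rational_distance_set_def parabola_def)
  then show ?thesis
    by (simp only: rds_tuples_def mem_Collect_eq eq)
qed

lemma closure_rds_tuples_2: "closure (rds_tuples :: (real ^ 2) set) = UNIV"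
proof -
  have "\<exists>y\<in>rds_tuples. dist y x < e" if e: "e > 0" for x :: "real ^ 2" and e
  proof -
    obtain r where r: "r \<in> \<rat>" "x $ 1 < r" "r < x $ 1 + e / 4"
      using Rats_dense_in_real[of "x $ 1" "x $ 1 + e / 4"] e by auto
    \<comment> \<open>The value 2 * r is avoided because it would make both coordinates r and s - r
      equal.\<close>
    obtain s where s: "s \<in> pythagorean_slopes" "\<bar>s - (x $ 1 + x $ 2)\<bar> < e / 4" "s \<notin> {2 * r}"
      using pythagorean_slopes_approx_avoiding[of "e / 4" "{2 * r}"] e by auto
    define y :: "real ^ 2" where "y = vector [r, s - r]"
    have y: "y $ 1 = r" "y $ 2 = s - r" by (simp_all add: y_def)
    have "s \<in> \<rat>" using s(1) by (simp add: pythagorean_slopes_def)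
    have "y \<in> rds_tuples"
    proof (rule in_rds_tuplesI)
      show "y $ i \<in> \<rat>" for i
        using r(1) \<open>s \<in> \<rat>\<close> exhaust_2[of i] by (auto simp: y)
      show "y $ i \<noteq> y $ j" "y $ i + y $ j \<in> pythagorean_slopes" if "i \<noteq> j" for i j
        using that s(1,3) exhaust_2[of i] exhaust_2[of j] by (auto simp: y)
    qed
    moreover have "dist y x < e"
    proof -
      have "dist y x \<le> \<bar>y $ 1 - x $ 1\<bar> + \<bar>y $ 2 - x $ 2\<bar>"
        using norm_le_l1_cart[of "y - x"] by (simp add: dist_norm sum_2)
      \<comment> \<open>The first coordinate is off by less than e / 4, the second by less than e /
        2, since the errors of r and s add up.\<close>
      also have "\<dots> < e" using r s(2) unfolding y by linarith
      finally show ?thesis .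
    qed
    ultimately show ?thesis by blast
  qed
  then show ?thesis by (auto simp: closure_approachable)
qed

lemma closure_rds_tuples_3: "closure (rds_tuples :: (real ^ 3) set) = UNIV"
proof -
  have "\<exists>y\<in>rds_tuples. dist y x < e" if e: "e > 0" for x :: "real ^ 3" and e
  proof -
    have e6: "e / 6 > 0" using e by simp
    \<comment> \<open>The sums s, t, u are chosen pairwise distinct because the differences of the
      coordinates of \<open>y\<close> below are, up to sign, their pairwise differences.\<close>
    obtain s where s: "s \<in> pythagorean_slopes" "\<bar>s - (x $ 1 + x $ 2)\<bar> < e / 6"
      using pythagorean_slopes_approx_avoiding[OF e6, of "{}"] by auto
    obtain t where t: "t \<in> pythagorean_slopes" "\<bar>t - (x $ 1 + x $ 3)\<bar> < e / 6" "t \<noteq> s"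
      using pythagorean_slopes_approx_avoiding[OF e6, of "{s}"] by auto
    obtain u where u: "u \<in> pythagorean_slopes" "\<bar>u - (x $ 2 + x $ 3)\<bar> < e / 6" "u \<noteq> s" "u \<noteq> t"
      using pythagorean_slopes_approx_avoiding[OF e6, of "{s, t}"] by auto
    \<comment> \<open>This is the unique solution of the linear system that prescribes the three
      pairwise sums s, t, u.\<close>
    define y :: "real ^ 3"
      where "y = vector [(s + t - u) / 2, (s + u - t) / 2, (t + u - s) / 2]"
    have y: "y $ 1 = (s + t - u) / 2" "y $ 2 = (s + u - t) / 2" "y $ 3 = (t + u - s) / 2"
      by (simp_all add: y_def)
    have rats: "s \<in> \<rat>" "t \<in> \<rat>" "u \<in> \<rat>"
      using s(1) t(1) u(1) by (simp_all add: pythagorean_slopes_def)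
    have sums: "y $ 1 + y $ 2 = s" "y $ 2 + y $ 1 = s" "y $ 1 + y $ 3 = t" "y $ 3 + y $ 1 = t"
      "y $ 2 + y $ 3 = u" "y $ 3 + y $ 2 = u"
      by (simp_all add: y field_simps)
    have "y \<in> rds_tuples"
    proof (rule in_rds_tuplesI)
      show "y $ i \<in> \<rat>" for i
        using rats exhaust_3[of i] by (auto simp: y)
      show "y $ i \<noteq> y $ j" if "i \<noteq> j" for i j
        using that t(3) u(3,4) exhaust_3[of i] exhaust_3[of j] by (auto simp: y)
      show "y $ i + y $ j \<in> pythagorean_slopes" if "i \<noteq> j" for i j
        using that s(1) t(1) u(1) exhaust_3[of i] exhaust_3[of j] by (auto simp: sums)
    qed
    moreover have "dist y x < e"
    proof -
      have "dist y x \<le> \<bar>y $ 1 - x $ 1\<bar> + \<bar>y $ 2 - x $ 2\<bar> + \<bar>y $ 3 - x $ 3\<bar>"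
        using norm_le_l1_cart[of "y - x"] by (simp add: dist_norm sum_3)
      also have "\<dots> < e"
      proof -
        \<comment> \<open>Each coordinate error is half a signed sum of the three errors of s, t, u,
          each below e / 6.\<close>
        have "\<bar>y $ 1 - x $ 1\<bar> < e / 4"
          using s(2) t(2) u(2) unfolding y abs_less_iff by (simp add: field_simps)
        moreover have "\<bar>y $ 2 - x $ 2\<bar> < e / 4"
          using s(2) t(2) u(2) unfolding y abs_less_iff by (simp add: field_simps)
        moreover have "\<bar>y $ 3 - x $ 3\<bar> < e / 4"
          using s(2) t(2) u(2) unfolding y abs_less_iff by (simp add: field_simps)
        ultimately show ?thesis using e by linarith
      qed
      finally show ?thesis .
    qed
    ultimately show ?thesis by blast
  qed
  then show ?thesis by (auto simp: closure_approachable)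
qed

theorem theorem4p2:
  shows "closure (rds_tuples :: (real ^ 2) set) = UNIV \<and>
         closure (rds_tuples :: (real ^ 3) set) = UNIV"
  using closure_rds_tuples_2 closure_rds_tuples_3 by blast

end
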